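(* Let $f$ and $a_i$, $i=1,\dots,m$, be convex functions and let $\{(x^k,y^k,s^k,\mu^k)\}\subset\mathbb{R}^n\times\mathbb{R}^m\times\mathbb{R}^m\times\mathbb{R}$ with $\mu^k>0$ and $\mu^k\to 0$ be such that: 1. $x^k\to x^*$ with $a(x^* )\le 0$, and $s^k\to s^*:=-a(x^* )$; 2. $y^k\ge 0$ and $s^k\ge 0$ with $y^k\to y^*$ ($y^*$ is necessarily a Lagrange multiplier associated with $x^*$); 3. for some $c\ge 0$ (independent of $k$), $(y^k)^{T}s^k\le\mu^k c$; 4. $0\le a_i(x^k)+s_i^k$ for all $i$ with $a_i(x^* )=0$; 5. for some $d\ge 0$ (independent of $k$), $\|\nabla_x\mathcal{L}(x^k,y^k)\|\le d\mu^k(\|y^k\|_1+1)$. Let $\tilde y\in\mathbb{R}^m$ be some Lagrange multiplier associated with $x^*$ such that, for some $u\ge 0$ and for all $i$ with $a_i(x^* )=0$: - $\dfrac{a_i(x^k)+s_i^k}{\mu^k}\to+\infty$ when $\tilde y_i=0$, and - $a_i(x^k)+s_i^k\le u\mu^k$ or $y_i^k\ge\tilde y_i$ when $\tilde y_i>0$. Then $y_i^*=0$ whenever $\tilde y_i=0$. In particular, if $\tilde y$ is minimally complementary, that is, it has a minimal number of non-zero elements (among all Lagrange multipliers associated with $x^*$), then $y^*$ is also minimally complementary.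
   Context: The functions $f:\mathbb{R}^n\to\mathbb{R}$ and $a=(a_1,\dots,a_m):\mathbb{R}^n\to\mathbb{R}^m$ are continuously differentiable. The problem under consideration is: minimize $f(x)$ subject to $a(x)+s=0$, $s\ge 0$ (equivalently, minimize $f(x)$ subject to $a(x)\le 0$). Vector inequalities are componentwise. The Lagrangian is $\mathcal{L}(x,y):=f(x)+y^{T}a(x)$. A Lagrange multiplier associated with a feasible point $x^*$ is a vector $y^*\in\mathbb{R}^m$ with $\nabla_x\mathcal{L}(x^*,y^* )=0$, $y^*\ge 0$ and $a(x^* )^{T}y^*=0$. $\|\cdot\|$ is the Euclidean norm, $\|\cdot\|_1$ the $\ell_1$-norm. Conditions on sequence elements stated without an explicit quantifier over $k$ are meant for all sufficiently large $k$. *)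

theory Defs
  imports "HOL-Analysis.Analysis"
begin

definition continuously_differentiable ::
    "('a::real_normed_vector \<Rightarrow> 'b::real_normed_vector) \<Rightarrow> bool" where
  "continuously_differentiable g \<longleftrightarrow>
     (\<exists>g' :: 'a \<Rightarrow> 'a \<Rightarrow>\<^sub>L 'b.
        (\<forall>x. (g has_derivative blinfun_apply (g' x)) (at x)) \<and> continuous_on UNIV g')"

text \<open>Only meaningful where \<open>g\<close> is differentiable; see \<open>gradient_eqI\<close>.\<close>

definition gradient :: "('a::real_inner \<Rightarrow> real) \<Rightarrow> 'a \<Rightarrow> 'a" where
  "gradient g x = (THE D. GDERIV g x :> D)"

lemma gradient_eqI:
  assumes "GDERIV g x :> D"
  shows "gradient g x = D"
  unfolding gradient_def
proof (rule the_equality[where P = "\<lambda>D. GDERIV g x :> D", OF assms])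
  fix D' assume "GDERIV g x :> D'"
  with assms have "(\<lambda>h. inner h D') = (\<lambda>h. inner h D)"
    unfolding gderiv_def by (rule has_derivative_unique[rotated])
  then have "inner (D' - D) D' = inner (D' - D) D"
    by metis
  then have "inner (D' - D) (D' - D) = 0"
    by (simp add: inner_diff_right)
  then show "D' = D" by simp
qed

definition l1_norm :: "real ^ 'm \<Rightarrow> real" where
  "l1_norm y = (\<Sum>i\<in>UNIV. \<bar>y $ i\<bar>)"

definition lagrangian ::
    "(real ^ 'n \<Rightarrow> real) \<Rightarrow> (real ^ 'n \<Rightarrow> real ^ 'm) \<Rightarrow> real ^ 'n \<Rightarrow> real ^ 'm \<Rightarrow> real" where
  "lagrangian f a x y = f x + y \<bullet> a x"

definition grad_lagrangian ::
    "(real ^ 'n \<Rightarrow> real) \<Rightarrow> (real ^ 'n \<Rightarrow> real ^ 'm) \<Rightarrow> real ^ 'n \<Rightarrow> real ^ 'm \<Rightarrow> real ^ 'n" where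
  "grad_lagrangian f a x y = gradient (\<lambda>z. lagrangian f a z y) x"

text \<open>The order on vectors is the componentwise one.\<close>

definition lagrange_multiplier ::
    "(real ^ 'n \<Rightarrow> real) \<Rightarrow> (real ^ 'n \<Rightarrow> real ^ 'm) \<Rightarrow> real ^ 'n \<Rightarrow> real ^ 'm \<Rightarrow> bool" where
  "lagrange_multiplier f a x y \<longleftrightarrow>
     a x \<le> 0 \<and> grad_lagrangian f a x y = 0 \<and> y \<ge> 0 \<and> a x \<bullet> y = 0"

definition minimally_complementary ::
    "(real ^ 'n \<Rightarrow> real) \<Rightarrow> (real ^ 'n \<Rightarrow> real ^ 'm) \<Rightarrow> real ^ 'n \<Rightarrow> real ^ 'm \<Rightarrow> bool" where
  "minimally_complementary f a x y \<longleftrightarrow>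
     lagrange_multiplier f a x y \<and>
     (\<forall>z. lagrange_multiplier f a x z \<longrightarrow> card {i. y $ i \<noteq> 0} \<le> card {i. z $ i \<noteq> 0})"

end

theory Submission
  imports Defs
begin

text \<open>Convexity of the Lagrangian in \<open>x\<close>, used between \<open>x*\<close> and \<open>x\<^sup>k\<close> once with
  the multiplier \<open>ytilde\<close> (for which \<open>x*\<close> is a global minimiser) and once with \<open>y\<^sup>k\<close>,
  bounds \<open>(y\<^sup>k - ytilde) \<bullet> a(x\<^sup>k) - y\<^sup>k \<bullet> a(x*)\<close> by a constant times \<open>\<mu>\<^sup>k\<close>. Writing
  \<open>w\<^sup>k = a(x\<^sup>k) + s\<^sup>k\<close> and using approximate complementarity, every summand
  \<open>(y\<^sub>i\<^sup>k - ytilde\<^sub>i) w\<^sub>i\<^sup>k - y\<^sub>i\<^sup>k a\<^sub>i(x*)\<close> is bounded below by \<open>- u ytilde\<^sub>i \<mu>\<^sup>k\<close>,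
  so the single summand \<open>y\<^sub>i\<^sup>k w\<^sub>i\<^sup>k\<close> with \<open>ytilde\<^sub>i = 0\<close> is \<open>O(\<mu>\<^sup>k)\<close>. As
  \<open>w\<^sub>i\<^sup>k / \<mu>\<^sup>k\<close> diverges, \<open>y\<^sub>i\<^sup>k\<close> tends to \<open>0\<close>.\<close>

section \<open>Gradients and convexity of the Lagrangian\<close>

lemma has_derivative_imp_GDERIV:
  fixes g :: "'a::euclidean_space \<Rightarrow> real"
  assumes "(g has_derivative D) (at x)"
  shows "GDERIV g x :> (\<Sum>b\<in>Basis. D b *\<^sub>R b)"
proof -
  have lin: "linear D"
    using assms has_derivative_linear by blast
  have "D h = h \<bullet> (\<Sum>b\<in>Basis. D b *\<^sub>R b)" for h
  proof -
    have "D h = D (\<Sum>b\<in>Basis. (h \<bullet> b) *\<^sub>R b)"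
      by (simp add: euclidean_representation)
    also have "\<dots> = (\<Sum>b\<in>Basis. (h \<bullet> b) * D b)"
      by (simp add: linear_sum[OF lin] linear_cmul[OF lin])
    also have "\<dots> = h \<bullet> (\<Sum>b\<in>Basis. D b *\<^sub>R b)"
      by (simp add: inner_sum_right mult.commute)
    finally show ?thesis .
  qed
  then have "D = (\<lambda>h. h \<bullet> (\<Sum>b\<in>Basis. D b *\<^sub>R b))" by blast
  then show ?thesis
    using assms unfolding gderiv_def by metis
qed

text \<open>Restricting \<open>g\<close> to the line through \<open>x\<close> and \<open>z\<close>
  reduces the claim to the one-variable tangent inequality, used between the parameters 0 and
  1.\<close>

lemma convex_on_imp_above_tangent_GDERIV:
  fixes g :: "'a::real_inner \<Rightarrow> real"
  assumes conv: "convex_on UNIV g" and D: "GDERIV g x :> D"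
  shows "g z \<ge> g x + D \<bullet> (z - x)"
proof -
  let ?l = "\<lambda>t. x + t *\<^sub>R (z - x)"
  have cl: "convex_on UNIV (\<lambda>t. g (?l t))"
  proof (rule convex_onI)
    fix t p q :: real assume t: "0 < t" "t < 1"
    have "?l ((1 - t) *\<^sub>R p + t *\<^sub>R q) = (1 - t) *\<^sub>R ?l p + t *\<^sub>R ?l q"
      by (simp add: algebra_simps)
    then show "g (?l ((1 - t) *\<^sub>R p + t *\<^sub>R q)) \<le> (1 - t) * g (?l p) + t * g (?l q)"
      using convex_onD[OF conv, of t "?l p" "?l q"] t by simp
  qed simp
  have "(?l has_derivative (\<lambda>t. t *\<^sub>R (z - x))) (at 0)"
    by (auto intro!: derivative_eq_intros)
  moreover have "(g has_derivative (\<lambda>h. h \<bullet> D)) (at (?l 0))"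
    using D by (simp add: gderiv_def)
  ultimately have "((\<lambda>t. g (?l t)) has_derivative (\<lambda>t. (t *\<^sub>R (z - x)) \<bullet> D)) (at 0)"
    by (rule has_derivative_compose)
  then have "((\<lambda>t. g (?l t)) has_field_derivative (D \<bullet> (z - x))) (at 0)"
    by (simp add: has_field_derivative_def inner_commute mult_commute_abs)
  then have "g (?l 1) - g (?l 0) \<ge> D \<bullet> (z - x) * (1 - 0)"
    by (intro convex_on_imp_above_tangent[OF cl]) auto
  then show ?thesis by simp
qed

lemma convex_on_sum_fun:
  fixes g :: "'i \<Rightarrow> 'a::real_vector \<Rightarrow> real"
  assumes "convex S" and "\<And>i. i \<in> I \<Longrightarrow> convex_on S (g i)"
  shows "convex_on S (\<lambda>z. \<Sum>i\<in>I. g i z)"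
  using assms(2)
  by (induction I rule: infinite_finite_induct)
    (auto intro!: convex_on_add simp: convex_on_const assms(1))

lemma convex_on_lagrangian:
  assumes "convex_on UNIV f" and "\<And>i. convex_on UNIV (\<lambda>z. a z $ i)" and "y \<ge> 0"
  shows "convex_on UNIV (\<lambda>z. lagrangian f a z y)"
proof -
  have "convex_on UNIV (\<lambda>z. \<Sum>i\<in>UNIV. y $ i * a z $ i)"
    using assms(2,3) by (intro convex_on_sum_fun convex_on_cmul) (auto simp: less_eq_vec_def)
  then show ?thesis
    unfolding lagrangian_def inner_vec_def inner_real_def
    by (intro convex_on_add assms(1))
qed

text \<open>The explicit coordinate formula serves twice: it shows that the definite description in
  \<open>gradient\<close> is meaningful, and it exhibits how the gradient depends on the point and
  the multiplier.\<close>

lemma GDERIV_lagrangian: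
  assumes "(f has_derivative f') (at x)" and "(a has_derivative a') (at x)"
  shows "GDERIV (\<lambda>z. lagrangian f a z y) x :> (\<Sum>b\<in>Basis. (f' b + y \<bullet> a' b) *\<^sub>R b)"
  unfolding lagrangian_def
  by (rule has_derivative_imp_GDERIV) (intro derivative_intros assms)

lemma GDERIV_grad_lagrangian:
  assumes "continuously_differentiable f" and "continuously_differentiable a"
  shows "GDERIV (\<lambda>z. lagrangian f a z y) x :> grad_lagrangian f a x y"
proof -
  obtain f' a' where "(f has_derivative f') (at x)" "(a has_derivative a') (at x)"
    using assms unfolding continuously_differentiable_def by meson
  note D = GDERIV_lagrangian[OF this, of y]
  show ?thesis
    unfolding grad_lagrangian_def gradient_eqI[OF D] by (rule D)
qed

text \<open>The coordinates of the gradient are built from \<open>f'\<close>, \<open>a'\<close> and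
  the multiplier by continuous operations, so continuity of both derivatives lets point and
  multiplier vary together.\<close>

lemma tendsto_grad_lagrangian:
  assumes "continuously_differentiable f" and "continuously_differentiable a"
    and x: "(x \<longlongrightarrow> x0) F" and y: "(y \<longlongrightarrow> y0) F"
  shows "((\<lambda>k. grad_lagrangian f a (x k) (y k)) \<longlongrightarrow> grad_lagrangian f a x0 y0) F"
proof -
  obtain f' where f': "\<And>z. (f has_derivative blinfun_apply (f' z)) (at z)" "continuous_on UNIV f'"
    using assms(1) unfolding continuously_differentiable_def by blast
  obtain a' where a': "\<And>z. (a has_derivative blinfun_apply (a' z)) (at z)" "continuous_on UNIV a'"
    using assms(2) unfolding continuously_differentiable_def by blast
  have eq: "grad_lagrangian f a z v = (\<Sum>b\<in>Basis. (f' z b + v \<bullet> a' z b) *\<^sub>R b)" for z v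
    unfolding grad_lagrangian_def using GDERIV_lagrangian[OF f'(1) a'(1)] by (rule gradient_eqI)
  have "((\<lambda>k. f' (x k)) \<longlongrightarrow> f' x0) F" "((\<lambda>k. a' (x k)) \<longlongrightarrow> a' x0) F"
    using continuous_on_tendsto_compose[OF f'(2) x] continuous_on_tendsto_compose[OF a'(2) x]
    by simp_all
  then show ?thesis
    unfolding eq
    by (intro tendsto_sum tendsto_scaleR tendsto_add tendsto_inner blinfun.tendsto tendsto_const y)
qed

lemma continuously_differentiable_imp_isCont:
  "continuously_differentiable g \<Longrightarrow> isCont g x"
  unfolding continuously_differentiable_def using has_derivative_continuous by blast

section \<open>Lagrange multipliers and complementarity\<close>

lemma minimally_complementary_if_support_subset:
  assumes "minimally_complementary f a x z" and "lagrange_multiplier f a x y"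
    and "\<And>i. z $ i = 0 \<Longrightarrow> y $ i = 0"
  shows "minimally_complementary f a x y"
proof -
  have "card {i. y $ i \<noteq> 0} \<le> card {i. z $ i \<noteq> 0}"
    using assms(3) by (intro card_mono) auto
  then show ?thesis
    using assms(1,2) unfolding minimally_complementary_def by (meson le_trans)
qed

text \<open>Stationarity survives the limit because \<open>y\<close> converges, so the bound on the
  gradient tends to 0. For complementarity, the bound \<open>\<mu> k * c\<close> gives one
  inequality in the limit and the signs of \<open>ystar\<close> and \<open>a xstar\<close> give the
  other.\<close>

lemma lagrange_multiplier_limit:
  assumes f: "continuously_differentiable f" and a: "continuously_differentiable a"
    and "\<mu> \<longlonglongrightarrow> 0" and x: "x \<longlonglongrightarrow> xstar" and feas: "a xstar \<le> 0"
    and s: "s \<longlonglongrightarrow> - a xstar"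
    and y_nonneg: "\<forall>\<^sub>F k in sequentially. y k \<ge> 0"
    and s_nonneg: "\<forall>\<^sub>F k in sequentially. s k \<ge> 0"
    and y: "y \<longlonglongrightarrow> ystar"
    and compl: "\<forall>\<^sub>F k in sequentially. y k \<bullet> s k \<le> \<mu> k * c"
    and grad: "\<forall>\<^sub>F k in sequentially.
           norm (grad_lagrangian f a (x k) (y k)) \<le> d * \<mu> k * (l1_norm (y k) + 1)"
  shows "lagrange_multiplier f a xstar ystar"
proof -
  have "(\<lambda>k. d * \<mu> k * (l1_norm (y k) + 1)) \<longlonglongrightarrow> d * 0 * (l1_norm ystar + 1)"
    unfolding l1_norm_def by (intro tendsto_intros assms)
  then have "(\<lambda>k. grad_lagrangian f a (x k) (y k)) \<longlonglongrightarrow> 0"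
    using Lim_null_comparison[OF grad] by simp
  then have grad0: "grad_lagrangian f a xstar ystar = 0"
    using tendsto_grad_lagrangian[OF f a x y] LIMSEQ_unique by blast
  have ynn: "ystar \<ge> 0"
    unfolding less_eq_vec_def
  proof
    fix i
    have "(\<lambda>k. y k $ i) \<longlonglongrightarrow> ystar $ i"
      by (intro tendsto_intros y)
    moreover have "\<forall>\<^sub>F k in sequentially. 0 $ i \<le> y k $ i"
      using y_nonneg by eventually_elim (simp add: less_eq_vec_def)
    ultimately show "0 $ i \<le> ystar $ i"
      by (rule tendsto_lowerbound) simp
  qed
  have lim: "(\<lambda>k. y k \<bullet> s k) \<longlonglongrightarrow> ystar \<bullet> (- a xstar)"
    by (intro tendsto_intros y s)
  have "(\<lambda>k. \<mu> k * c) \<longlonglongrightarrow> 0 * c"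
    by (intro tendsto_intros assms)
  then have "ystar \<bullet> (- a xstar) \<le> 0"
    using tendsto_le[OF _ _ lim compl, of 0] by simp
  moreover have "\<forall>i. ystar $ i * a xstar $ i \<le> 0"
    using ynn feas by (auto simp: less_eq_vec_def mult_nonneg_nonpos)
  then have "ystar \<bullet> a xstar \<le> 0"
    by (auto simp: inner_vec_def intro!: sum_nonpos)
  ultimately have "a xstar \<bullet> ystar = 0"
    by (simp add: inner_commute)
  then show ?thesis
    using grad0 ynn feas by (simp add: lagrange_multiplier_def)
qed

lemma inner_nonpos_eq_0_iff:
  fixes v w :: "real ^ 'n"
  assumes "v \<le> 0" and "w \<ge> 0"
  shows "v \<bullet> w = 0 \<longleftrightarrow> (\<forall>i. v $ i * w $ i = 0)"
proof -
  have "\<And>i. - (v $ i * w $ i) \<ge> 0"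
    using assms by (auto simp: less_eq_vec_def mult_nonpos_nonneg)
  then have "(\<Sum>i\<in>UNIV. - (v $ i * w $ i)) = 0 \<longleftrightarrow> (\<forall>i. v $ i * w $ i = 0)"
    by (subst sum_nonneg_eq_0_iff) auto
  then show ?thesis
    by (simp add: inner_vec_def sum_negf)
qed

text \<open>Stationarity makes \<open>xstar\<close> a global minimiser of the convex Lagrangian with
  multiplier \<open>z\<close>. Adding this to the tangent inequality at \<open>x\<close> for the
  multiplier \<open>y\<close> cancels \<open>f\<close>, and complementarity of \<open>z\<close>
  removes \<open>z \<bullet> a xstar\<close>.\<close>

lemma lagrangian_gap:
  assumes f: "continuously_differentiable f" and a: "continuously_differentiable a"
    and cf: "convex_on UNIV f" and ca: "\<And>i. convex_on UNIV (\<lambda>z. a z $ i)"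
    and "lagrange_multiplier f a xstar z" and "y \<ge> 0"
  shows "(y - z) \<bullet> a x - y \<bullet> a xstar \<le> norm (grad_lagrangian f a x y) * norm (xstar - x)"
proof -
  have z: "z \<ge> 0" "grad_lagrangian f a xstar z = 0" "z \<bullet> a xstar = 0"
    using assms(5) by (auto simp: lagrange_multiplier_def inner_commute)
  have "lagrangian f a x z \<ge> lagrangian f a xstar z"
    using convex_on_imp_above_tangent_GDERIV[OF convex_on_lagrangian[OF cf ca z(1)]
        GDERIV_grad_lagrangian[OF f a], of xstar x] z(2) by simp
  moreover have "lagrangian f a xstar y \<ge>
      lagrangian f a x y + grad_lagrangian f a x y \<bullet> (xstar - x)"
    by (intro convex_on_imp_above_tangent_GDERIV convex_on_lagrangian
        GDERIV_grad_lagrangian assms)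
  moreover have "\<bar>grad_lagrangian f a x y \<bullet> (xstar - x)\<bar>
      \<le> norm (grad_lagrangian f a x y) * norm (xstar - x)"
    by (rule Cauchy_Schwarz_ineq2)
  ultimately show ?thesis
    using z(3) by (simp add: lagrangian_def inner_diff_left)
qed

section \<open>The limit multiplier vanishes wherever \<open>ytilde\<close> does\<close>

theorem theorem6:
  fixes f :: "real ^ 'n \<Rightarrow> real"
    and a :: "real ^ 'n \<Rightarrow> real ^ 'm"
    and x :: "nat \<Rightarrow> real ^ 'n" and y s :: "nat \<Rightarrow> real ^ 'm" and \<mu> :: "nat \<Rightarrow> real"
    and xstar :: "real ^ 'n" and ystar sstar ytilde :: "real ^ 'm"
    and c d u :: real
  assumes "continuously_differentiable f" and "continuously_differentiable a"
    and "convex_on UNIV f" and "\<And>i. convex_on UNIV (\<lambda>z. a z $ i)"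
    and "\<forall>\<^sub>F k in sequentially. \<mu> k > 0" and "\<mu> \<longlonglongrightarrow> 0"
    and "x \<longlonglongrightarrow> xstar" and "a xstar \<le> 0"
    and "sstar = - a xstar" and "s \<longlonglongrightarrow> sstar"
    and "\<forall>\<^sub>F k in sequentially. y k \<ge> 0" and "\<forall>\<^sub>F k in sequentially. s k \<ge> 0"
    and "y \<longlonglongrightarrow> ystar"
    and "c \<ge> 0" and "\<forall>\<^sub>F k in sequentially. y k \<bullet> s k \<le> \<mu> k * c"
    and "\<And>i. a xstar $ i = 0 \<Longrightarrow> \<forall>\<^sub>F k in sequentially. 0 \<le> a (x k) $ i + s k $ i"
    and "d \<ge> 0"
    and "\<forall>\<^sub>F k in sequentially.
           norm (grad_lagrangian f a (x k) (y k)) \<le> d * \<mu> k * (l1_norm (y k) + 1)"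
    and "lagrange_multiplier f a xstar ytilde"
    and "u \<ge> 0"
    and "\<And>i. a xstar $ i = 0 \<Longrightarrow> ytilde $ i = 0 \<Longrightarrow>
           filterlim (\<lambda>k. (a (x k) $ i + s k $ i) / \<mu> k) at_top sequentially"
    and "\<And>i. a xstar $ i = 0 \<Longrightarrow> ytilde $ i > 0 \<Longrightarrow>
           \<forall>\<^sub>F k in sequentially. a (x k) $ i + s k $ i \<le> u * \<mu> k \<or> y k $ i \<ge> ytilde $ i"
  shows "lagrange_multiplier f a xstar ystar \<and>
         (\<forall>i. ytilde $ i = 0 \<longrightarrow> ystar $ i = 0) \<and>
         (minimally_complementary f a xstar ytilde \<longrightarrow> minimally_complementary f a xstar ystar)"
proof -
  note f = assms(1) and a = assms(2) and cf = assms(3) and ca = assms(4)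
    and mu_pos = assms(5) and mu = assms(6) and x = assms(7) and feas = assms(8)
    and y_nonneg = assms(11) and s_nonneg = assms(12) and y = assms(13)
    and compl = assms(15) and active = assms(16) and grad = assms(18)
    and ytilde = assms(19) and slow = assms(21) and fast = assms(22)
  have s: "s \<longlonglongrightarrow> - a xstar"
    using assms(9,10) by simp
  have mult: "lagrange_multiplier f a xstar ystar"
    by (rule lagrange_multiplier_limit[OF f a mu x feas s y_nonneg s_nonneg y compl grad])
  have yt: "ytilde \<ge> 0" "\<And>i. a xstar $ i * ytilde $ i = 0"
    using ytilde inner_nonpos_eq_0_iff[OF feas] by (auto simp: lagrange_multiplier_def)
  have ys: "\<And>i. a xstar $ i * ystar $ i = 0"
    using mult inner_nonpos_eq_0_iff[OF feas] by (auto simp: lagrange_multiplier_def)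
  define w where "w k = a (x k) + s k" for k
  have w: "w \<longlonglongrightarrow> 0"
  proof -
    have "w \<longlonglongrightarrow> a xstar + - a xstar"
      unfolding w_def
      by (intro tendsto_add s isCont_tendsto_compose[OF continuously_differentiable_imp_isCont[OF a] x])
    then show ?thesis by simp
  qed
  define T where "T k i = (y k $ i - ytilde $ i) * w k $ i - y k $ i * a xstar $ i" for k i
  have T_lower: "\<forall>\<^sub>F k in sequentially. T k i \<ge> - (u * ytilde $ i * \<mu> k)" for i
  proof (cases "a xstar $ i = 0")
    case True
    have *: "\<forall>\<^sub>F k in sequentially. ytilde $ i = 0 \<or> w k $ i \<le> u * \<mu> k \<or> y k $ i \<ge> ytilde $ i"
      using fast[OF True] yt(1)
      by (cases "ytilde $ i = 0") (auto simp: w_def less_eq_vec_def order.strict_iff_order)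
    show ?thesis
      using * active[OF True] y_nonneg mu_pos
    proof eventually_elim
      case (elim k)
      have nn: "w k $ i \<ge> 0" "y k $ i \<ge> 0" "ytilde $ i \<ge> 0"
        using elim yt(1) by (auto simp: w_def less_eq_vec_def)
      show ?case
      \<comment> \<open>Either both factors of the product are nonnegative, or \<open>w\<close> is
        at most \<open>u * \<mu> k\<close> and the only negative term,
        \<open>- ytilde $ i * w k $ i\<close>, is controlled by it.\<close>
      proof (cases "y k $ i \<ge> ytilde $ i")
        case True
        have "0 \<le> (y k $ i - ytilde $ i) * w k $ i"
          using True nn by simp
        moreover have "0 \<le> u * ytilde $ i * \<mu> k"
          using \<open>u \<ge> 0\<close> nn elim by simp
        ultimately show ?thesis
          using \<open>a xstar $ i = 0\<close> by (simp add: T_def)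
      next
        case False
        then have "w k $ i \<le> u * \<mu> k"
          using elim nn by auto
        then have "ytilde $ i * w k $ i \<le> ytilde $ i * (u * \<mu> k)"
          using nn by (intro mult_left_mono)
        moreover have "0 \<le> y k $ i * w k $ i"
          using nn by simp
        ultimately show ?thesis
          using \<open>a xstar $ i = 0\<close> by (simp add: T_def algebra_simps)
      qed
    qed
  next
    case False
    \<comment> \<open>For an inactive constraint no sign of \<open>w\<close> is known. But
      \<open>ytilde\<close> vanishes there, so the summand is
      \<open>y k $ i * (w k $ i - a xstar $ i)\<close>, whose second factor is eventually
      positive.\<close>
    then have neg: "a xstar $ i < 0" and yt0: "ytilde $ i = 0"
      using feas yt(2)[of i] by (auto simp: less_eq_vec_def order.strict_iff_order)
    have "(\<lambda>k. w k $ i) \<longlonglongrightarrow> 0 $ i"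
      by (intro tendsto_intros w)
    then have "\<forall>\<^sub>F k in sequentially. w k $ i > a xstar $ i"
      using neg by (simp add: order_tendsto_iff)
    then show ?thesis
      using y_nonneg
    proof eventually_elim
      case (elim k)
      have "0 \<le> y k $ i * (w k $ i - a xstar $ i)"
        using elim by (simp add: less_eq_vec_def)
      then show ?case
        using yt0 by (simp add: T_def algebra_simps)
    qed
  qed
  \<comment> \<open>Passing from \<open>a (x k)\<close> to \<open>w k\<close> costs only
    \<open>y k \<bullet> s k\<close>, at most \<open>\<mu> k * c\<close>, and a nonpositive
    term.\<close>
  have T_sum: "(\<Sum>i\<in>UNIV. T k i) =
      ((y k - ytilde) \<bullet> a (x k) - y k \<bullet> a xstar) + y k \<bullet> s k - ytilde \<bullet> s k" for k
    by (simp add: T_def w_def inner_vec_def sum_subtractf sum.distrib algebra_simps)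
  \<comment> \<open>\<open>\<mu> k * E k\<close> bounds the right-hand side of
    \<open>lagrangian_gap\<close>. Since \<open>E\<close> tends to 0, it is eventually below 1,
    which is the 1 in \<open>1 + c\<close>.\<close>
  define E where "E k = d * (l1_norm (y k) + 1) * norm (xstar - x k)" for k
  have "E \<longlonglongrightarrow> d * (l1_norm ystar + 1) * norm (xstar - xstar)"
    unfolding E_def l1_norm_def by (intro tendsto_intros x y)
  then have E: "\<forall>\<^sub>F k in sequentially. E k < 1"
    by (simp add: order_tendsto_iff)
  have T_upper: "\<forall>\<^sub>F k in sequentially. (\<Sum>i\<in>UNIV. T k i) \<le> (1 + c) * \<mu> k"
    using E grad compl y_nonneg s_nonneg mu_pos
  proof eventually_elim
    case (elim k)
    have "ytilde \<bullet> s k \<ge> 0"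
      using yt(1) elim by (auto simp: inner_vec_def less_eq_vec_def intro!: sum_nonneg)
    moreover have "norm (grad_lagrangian f a (x k) (y k)) * norm (xstar - x k) \<le> \<mu> k * E k"
      using mult_right_mono[OF elim(2), of "norm (xstar - x k)"] by (simp add: E_def mult_ac)
    moreover have "\<mu> k * E k \<le> \<mu> k * 1"
      using elim by (intro mult_left_mono) auto
    moreover have "(y k - ytilde) \<bullet> a (x k) - y k \<bullet> a xstar
        \<le> norm (grad_lagrangian f a (x k) (y k)) * norm (xstar - x k)"
      using elim by (intro lagrangian_gap[OF f a cf ca ytilde])
    ultimately show ?case
      using elim(3) unfolding T_sum by (simp add: algebra_simps)
  qed
  \<comment> \<open>The part \<open>1 + c\<close> is the upper bound for the whole sum; the rest
    compensates the lower bounds of the other summands.\<close>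
  define C where "C = 1 + c + (\<Sum>i\<in>UNIV. u * ytilde $ i)"
  have zero: "ystar $ i = 0" if i: "ytilde $ i = 0" for i
  proof (cases "a xstar $ i = 0")
    case False
    then show ?thesis using ys[of i] by simp
  next
    case True
    have all_lower: "\<forall>\<^sub>F k in sequentially. \<forall>j. T k j \<ge> - (u * ytilde $ j * \<mu> k)"
      using T_lower by (simp add: eventually_all_finite)
    have w_top: "filterlim (\<lambda>k. w k $ i / \<mu> k) at_top sequentially"
      using slow[OF True i] by (simp add: w_def)
    \<comment> \<open>Isolating the summand \<open>i\<close> yields
      \<open>y k $ i * w k $ i \<le> C * \<mu> k\<close>; divergence of
      \<open>w k $ i / \<mu> k\<close> also supplies the positivity of \<open>w k $ i\<close> needed
      to divide.\<close>
    have "\<forall>\<^sub>F k in sequentially. norm (y k $ i) \<le> C / (w k $ i / \<mu> k)"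
      using all_lower T_upper mu_pos y_nonneg
        filterlim_at_top_dense[THEN iffD1, OF w_top, rule_format, of 0]
    proof eventually_elim
      case (elim k)
      have "T k i + (\<Sum>j\<in>UNIV - {i}. - (u * ytilde $ j * \<mu> k)) \<le>
          T k i + (\<Sum>j\<in>UNIV - {i}. T k j)"
        using elim(1) by (intro add_left_mono sum_mono) auto
      also have "\<dots> = (\<Sum>j\<in>UNIV. T k j)"
        by (rule sum.remove[symmetric]) auto
      also have "\<dots> \<le> (1 + c) * \<mu> k"
        by (rule elim(2))
      finally have "T k i \<le> (1 + c) * \<mu> k + (\<Sum>j\<in>UNIV - {i}. u * ytilde $ j * \<mu> k)"
        by (simp add: sum_negf)
      \<comment> \<open>The index \<open>i\<close> may be put back because
        \<open>ytilde $ i = 0\<close>, which keeps \<open>C\<close> independent of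
        \<open>i\<close>.\<close>
      also have "(\<Sum>j\<in>UNIV - {i}. u * ytilde $ j * \<mu> k) = (\<Sum>j\<in>UNIV. u * ytilde $ j * \<mu> k)"
        using i by (intro sum.mono_neutral_left) auto
      finally have "y k $ i * w k $ i \<le> C * \<mu> k"
        using True i by (simp add: T_def C_def distrib_right sum_distrib_right)
      moreover have "w k $ i > 0" "y k $ i \<ge> 0"
        using elim by (auto simp: less_eq_vec_def zero_less_divide_iff)
      ultimately show ?case
        by (simp add: pos_le_divide_eq)
    qed
    moreover have "(\<lambda>k. C / (w k $ i / \<mu> k)) \<longlonglongrightarrow> 0"
      using w_top by (intro tendsto_divide_0[OF tendsto_const])
        (rule filterlim_at_top_imp_at_infinity)
    ultimately have "(\<lambda>k. y k $ i) \<longlonglongrightarrow> 0"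
      by (rule Lim_null_comparison)
    moreover have "(\<lambda>k. y k $ i) \<longlonglongrightarrow> ystar $ i"
      by (intro tendsto_intros y)
    ultimately show ?thesis
      using LIMSEQ_unique by blast
  qed
  then show ?thesis
    using minimally_complementary_if_support_subset[OF _ mult] by (intro conjI impI allI mult) auto
qed

end
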